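(* Let $d\in\mathbb N$, let $(t_k)_{k\ge1}\subset\mathbb C$ satisfy $t_1=0$, $|t_2|<\frac12$, $t_k=0$ for $k>d+1$, let $D\subset\mathbb C$ be a compact domain with twice continuously differentiable boundary, containing the origin as an interior point, such that $U(z)=|z|^2-2\,\mathrm{Re}\sum_{k=1}^{d+1}t_kz^k$ is positive on $D\setminus\{0\}$, let $t_0>0$ be sufficiently small, and let $V=\frac1{t_0}U$ and $N\in\mathbb N$. Let $L_N$ be the operator of multiplication by $z$ in the basis of orthonormal polynomials for $V$ on $D$, and $L_N^*$ its adjoint. Then for $1\le k\le d+1$ $$\frac{\partial L_N}{\partial t_k}=\frac N{t_0}[L_N,M^{(k)}_N],\qquad\frac{\partial L_N^*}{\partial t_k}=\frac N{t_0}[L_N^*,M^{(k)}_N],$$ $$\frac{\partial L_N}{\partial\bar t_k}=\frac N{t_0}[M^{(k)*}_N,L_N],\qquad\frac{\partial L_N^*}{\partial\bar t_k}=\frac N{t_0}[M^{(k)*}_N,L_N^*],$$ where, writing $O_+$, $O_-$, $O_0$ for the (strictly) lower triangular, (strictly) upper triangular and diagonal part of an operator $O$, $$M^{(k)}_N=(L_N^k)_++\tfrac12(L_N^k)_0,\qquad M^{(k)*}_N=((L_N^* )^k)_-+\tfrac12((L_N^* )^k)_0 .$$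
   Context: On polynomials consider the inner product $(f,g)_N=\int_D\overline{f(z)}g(z)e^{-NV(z)}\,d^2z$. Let $p_{n,N}$, $n\in\mathbb N_0$, be the monic polynomials of degree $n$ with $(p_{m,N},p_{n,N})_N=\delta_{m,n}h_{n,N}$, $h_{n,N}>0$, and $q_{n,N}=h_{n,N}^{-1/2}p_{n,N}$ the orthonormal polynomials. $L_N$ acts on the completion of the space of polynomials by $L_Nq_{n,N}(z)=zq_{n,N}(z)$. Operators are identified with their matrices $O_{m,n,N}=(q_{m,N},O_Nq_{n,N})_N$, $m,n\in\mathbb N_0$; "lower triangular" refers to entries with $m>n$. One has $L_{m,n,N}=0$ for $m\ge n+2$, so that all matrix products occurring are given by finite sums. The potential is regarded as a function of the complex parameters $t_1,\dots,t_{d+1}$ (with $t_0$, $N$, $D$ fixed), $V(z)=\frac1{t_0}\big(|z|^2-\sum_{k=1}^{d+1}(t_kz^k+\bar t_k\bar z^k)\big)$; the derivatives $\partial/\partial t_k$, $\partial/\partial\bar t_k$ are Wirtinger derivatives of the matrix elements, evaluated at the given parameter values. *)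

theory Defs
  imports "HOL-Analysis.Analysis" "HOL-Computational_Algebra.Polynomial"
begin

subsection \<open>Compact domains with twice continuously differentiable boundary\<close>

definition C2_on :: "(complex \<Rightarrow> real) \<Rightarrow> complex set \<Rightarrow> bool" where
  "C2_on f W \<longleftrightarrow>
     (\<exists>(f' :: complex \<Rightarrow> (complex \<Rightarrow>\<^sub>L real)) (f'' :: complex \<Rightarrow> (complex \<Rightarrow>\<^sub>L (complex \<Rightarrow>\<^sub>L real))).
        (\<forall>z\<in>W. (f has_derivative blinfun_apply (f' z)) (at z)) \<and>
        (\<forall>z\<in>W. (f' has_derivative blinfun_apply (f'' z)) (at z)) \<and>
        continuous_on W f'')"

text \<open>Near each of its boundary points, the set is a sublevel set of a \<open>C\<^sup>2\<close> function
  whose differential does not vanish there.\<close>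

definition C2_boundary :: "complex set \<Rightarrow> bool" where
  "C2_boundary D \<longleftrightarrow>
     (\<forall>p\<in>frontier D. \<exists>W \<rho>. open W \<and> p \<in> W \<and> C2_on \<rho> W \<and>
        (\<forall>z\<in>W. \<not> (\<rho> has_derivative (\<lambda>_. 0)) (at z)) \<and>
        D \<inter> W = {z\<in>W. \<rho> z \<le> 0})"

definition compact_C2_domain :: "complex set \<Rightarrow> bool" where
  "compact_C2_domain D \<longleftrightarrow>
     compact D \<and> connected (interior D) \<and> D = closure (interior D) \<and> C2_boundary D"


subsection \<open>Potential, inner product and orthogonal polynomials\<close>

text \<open>The parameters \<open>t\<^sub>1, \<dots>, t\<^sub>d\<^sub>+\<^sub>1\<close> are the values of a function on \<open>nat\<close>, of which the value
  at \<open>0\<close> is never used; the parameter \<open>t\<^sub>0\<close> is a separate real number.\<close>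

definition pot_U :: "nat \<Rightarrow> (nat \<Rightarrow> complex) \<Rightarrow> complex \<Rightarrow> real" where
  "pot_U d t z = (cmod z)\<^sup>2 - 2 * Re (\<Sum>k=1..d+1. t k * z ^ k)"

definition pot_V :: "nat \<Rightarrow> real \<Rightarrow> (nat \<Rightarrow> complex) \<Rightarrow> complex \<Rightarrow> real" where
  "pot_V d t0 t z = pot_U d t z / t0"

definition poly_inner ::
    "complex set \<Rightarrow> (complex \<Rightarrow> real) \<Rightarrow> nat \<Rightarrow> complex poly \<Rightarrow> complex poly \<Rightarrow> complex" where
  "poly_inner D V N f g =
     set_lebesgue_integral lborel D
       (\<lambda>z. cnj (poly f z) * poly g z * of_real (exp (- real N * V z)))"

definition is_monic_orth ::
    "complex set \<Rightarrow> (complex \<Rightarrow> real) \<Rightarrow> nat \<Rightarrow> (nat \<Rightarrow> complex poly) \<Rightarrow> (nat \<Rightarrow> real) \<Rightarrow> bool" where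
  "is_monic_orth D V N p h \<longleftrightarrow>
     (\<forall>n. degree (p n) = n \<and> lead_coeff (p n) = 1 \<and> h n > 0) \<and>
     (\<forall>m n. poly_inner D V N (p m) (p n) = (if m = n then of_real (h n) else 0))"

text \<open>The pair \<open>(p, h)\<close> exists and is unique whenever \<open>D\<close> is compact with nonempty interior
  and \<open>V\<close> is continuous.\<close>

definition monic_orth ::
    "complex set \<Rightarrow> (complex \<Rightarrow> real) \<Rightarrow> nat \<Rightarrow> (nat \<Rightarrow> complex poly) \<times> (nat \<Rightarrow> real)" where
  "monic_orth D V N = (THE (p, h). is_monic_orth D V N p h)"

definition orthonormal_poly ::
    "complex set \<Rightarrow> (complex \<Rightarrow> real) \<Rightarrow> nat \<Rightarrow> nat \<Rightarrow> complex poly" where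
  "orthonormal_poly D V N n =
     (case monic_orth D V N of (p, h) \<Rightarrow> smult (of_real (1 / sqrt (h n))) (p n))"


subsection \<open>Operators as infinite matrices\<close>

type_synonym cmat = "nat \<Rightarrow> nat \<Rightarrow> complex"

definition mult_z_mat :: "complex set \<Rightarrow> (complex \<Rightarrow> real) \<Rightarrow> nat \<Rightarrow> cmat" where
  "mult_z_mat D V N m n =
     poly_inner D V N (orthonormal_poly D V N m) ([:0, 1:] * orthonormal_poly D V N n)"

definition adj :: "cmat \<Rightarrow> cmat" where
  "adj A m n = cnj (A n m)"

text \<open>In all products formed below, only finitely many summands are nonzero.\<close>

definition mat_mul :: "cmat \<Rightarrow> cmat \<Rightarrow> cmat" where
  "mat_mul A B m n = (\<Sum>\<^sub>\<infinity>j\<in>UNIV. A m j * B j n)"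

primrec mat_pow :: "cmat \<Rightarrow> nat \<Rightarrow> cmat" where
  "mat_pow A 0 = (\<lambda>m n. if m = n then 1 else 0)"
| "mat_pow A (Suc k) = mat_mul A (mat_pow A k)"

definition commutator :: "cmat \<Rightarrow> cmat \<Rightarrow> cmat" where
  "commutator A B m n = mat_mul A B m n - mat_mul B A m n"

definition mat_scale :: "complex \<Rightarrow> cmat \<Rightarrow> cmat" where
  "mat_scale c A m n = c * A m n"

definition mat_add :: "cmat \<Rightarrow> cmat \<Rightarrow> cmat" where
  "mat_add A B m n = A m n + B m n"

definition lower_part :: "cmat \<Rightarrow> cmat" where
  "lower_part A m n = (if m > n then A m n else 0)"

definition upper_part :: "cmat \<Rightarrow> cmat" where
  "upper_part A m n = (if m < n then A m n else 0)"

definition diag_part :: "cmat \<Rightarrow> cmat" where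
  "diag_part A m n = (if m = n then A m n else 0)"

definition M_mat :: "cmat \<Rightarrow> nat \<Rightarrow> cmat" where
  "M_mat L k = mat_add (lower_part (mat_pow L k)) (mat_scale (1/2) (diag_part (mat_pow L k)))"

definition M_star_mat :: "cmat \<Rightarrow> nat \<Rightarrow> cmat" where
  "M_star_mat L k =
     mat_add (upper_part (mat_pow (adj L) k)) (mat_scale (1/2) (diag_part (mat_pow (adj L) k)))"


subsection \<open>Wirtinger derivatives\<close>

text \<open>\<open>\<partial>/\<partial>z = (\<partial>/\<partial>x - i \<partial>/\<partial>y) / 2\<close> and \<open>\<partial>/\<partial>z* = (\<partial>/\<partial>x + i \<partial>/\<partial>y) / 2\<close>, where \<open>f'\<close> below is the
  real differential and \<open>z*\<close> the conjugate of \<open>z\<close>. Real differentiability is part of both notions.\<close>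

definition has_wirtinger :: "(complex \<Rightarrow> complex) \<Rightarrow> complex \<Rightarrow> complex \<Rightarrow> bool" where
  "has_wirtinger f a z \<longleftrightarrow>
     (\<exists>f'. (f has_derivative f') (at z) \<and> a = (f' 1 - \<i> * f' \<i>) / 2)"

definition has_wirtinger_bar :: "(complex \<Rightarrow> complex) \<Rightarrow> complex \<Rightarrow> complex \<Rightarrow> bool" where
  "has_wirtinger_bar f a z \<longleftrightarrow>
     (\<exists>f'. (f has_derivative f') (at z) \<and> a = (f' 1 + \<i> * f' \<i>) / 2)"

definition mat_has_wirtinger :: "(complex \<Rightarrow> cmat) \<Rightarrow> cmat \<Rightarrow> complex \<Rightarrow> bool" where
  "mat_has_wirtinger F A z \<longleftrightarrow> (\<forall>m n. has_wirtinger (\<lambda>s. F s m n) (A m n) z)"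

definition mat_has_wirtinger_bar :: "(complex \<Rightarrow> cmat) \<Rightarrow> cmat \<Rightarrow> complex \<Rightarrow> bool" where
  "mat_has_wirtinger_bar F A z \<longleftrightarrow> (\<forall>m n. has_wirtinger_bar (\<lambda>s. F s m n) (A m n) z)"

end

theory Submission
  imports Defs
begin

text \<open>The deformation multiplies the weight by \<open>exp (2 c Re (s z\<^sup>k))\<close> with \<open>c = N / t\<^sub>0\<close>, so that
  \<open>\<partial>(f,g) = c (f, z\<^sup>k g)\<close>. The derivatives \<open>\<partial>q\<^sub>n = \<Sum> A\<^sub>m\<^sub>n q\<^sub>m\<close> and \<open>\<partial>* q\<^sub>n = \<Sum> B\<^sub>m\<^sub>n q\<^sub>m\<close> have upper
  triangular coefficient matrices, and differentiating \<open>(q\<^sub>m,q\<^sub>n) = \<delta>\<^sub>m\<^sub>n\<close> gives \<open>A + B* = -c L\<^sup>k\<close>. Since the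
  leading coefficients are real, \<open>A\<close> and \<open>B*\<close> share their diagonal, whence \<open>B* = -c M\<close> and
  \<open>A = -c (L\<^sup>k - M)\<close>. Differentiating \<open>L\<^sub>m\<^sub>n = (q\<^sub>m, z q\<^sub>n)\<close> turns this into the commutators.\<close>

subsection \<open>Wirtinger calculus\<close>

text \<open>Both Wirtinger derivatives at once, as the two coefficients of the real differential.
  Every calculus rule then comes from the corresponding one for
  \<open>has_derivative\<close>.\<close>

definition wirtinger_pair :: "(complex \<Rightarrow> complex) \<Rightarrow> complex \<Rightarrow> complex \<Rightarrow> complex \<Rightarrow> bool" where
  "wirtinger_pair f a b z \<longleftrightarrow> (f has_derivative (\<lambda>v. a * v + b * cnj v)) (at z)"

lemma wirtinger_pairD:
  assumes "wirtinger_pair f a b z"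
  shows "has_wirtinger f a z" "has_wirtinger_bar f b z"
proof -
  let ?f' = "\<lambda>v. a * v + b * cnj v"
  have "a = (?f' 1 - \<i> * ?f' \<i>) / 2" "b = (?f' 1 + \<i> * ?f' \<i>) / 2"
    by (simp_all add: algebra_simps)
  then show "has_wirtinger f a z" "has_wirtinger_bar f b z"
    using assms unfolding wirtinger_pair_def has_wirtinger_def has_wirtinger_bar_def by blast+
qed

text \<open>A real linear map on the complex plane is determined by its values at \<open>1\<close>
  and \<open>\<i>\<close>, hence has the form \<open>a * v + b * cnj v\<close>.\<close>

lemma differentiable_imp_wirtinger_pair:
  assumes "f differentiable at z"
  shows "\<exists>a b. wirtinger_pair f a b z"
proof -
  obtain f' where f': "(f has_derivative f') (at z)"
    using assms by (auto simp: differentiable_def)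
  interpret bounded_linear f' by (rule has_derivative_bounded_linear[OF f'])
  define a where "a = (f' 1 - \<i> * f' \<i>) / 2"
  define b where "b = (f' 1 + \<i> * f' \<i>) / 2"
  have "f' v = a * v + b * cnj v" for v
  proof -
    have "v = Re v *\<^sub>R 1 + Im v *\<^sub>R \<i>"
      by (simp add: complex_eq_iff)
    then have "f' v = f' (Re v *\<^sub>R 1 + Im v *\<^sub>R \<i>)"
      by (rule arg_cong)
    also have "\<dots> = Re v *\<^sub>R f' 1 + Im v *\<^sub>R f' \<i>"
      by (simp only: add scaleR)
    also have "\<dots> = a * v + b * cnj v"
      by (simp add: a_def b_def complex_eq_iff field_simps)
    finally show ?thesis .
  qed
  then have "f' = (\<lambda>v. a * v + b * cnj v)" by blast
  then show ?thesis
    using f' unfolding wirtinger_pair_def by blast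
qed

lemma wirtinger_pair_imp_differentiable:
  "wirtinger_pair f a b z \<Longrightarrow> f differentiable at z"
  by (auto simp: wirtinger_pair_def differentiable_def)

text \<open>Uniqueness turns identities valid for all parameters, such as orthonormality, into
  equations between derivatives.\<close>

lemma wirtinger_pair_unique:
  assumes "wirtinger_pair f a b z" "wirtinger_pair f a' b' z"
  shows "a = a'" "b = b'"
proof -
  have "(\<lambda>v. a * v + b * cnj v) = (\<lambda>v. a' * v + b' * cnj v)"
    using assms unfolding wirtinger_pair_def by (rule has_derivative_unique)
  from fun_cong[OF this, of 1] fun_cong[OF this, of \<i>]
  have "a + b = a' + b'" "a - b = a' - b'"
    by (simp_all add: algebra_simps complex_eq_iff)
  then have "2 * a = 2 * a'" "2 * b = 2 * b'" by algebra+
  then show "a = a'" "b = b'" by simp_all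
qed

lemma wirtinger_pair_const: "wirtinger_pair (\<lambda>_. a) 0 0 z"
  by (simp add: wirtinger_pair_def)

text \<open>Conjugation exchanges the roles of \<open>v\<close> and \<open>cnj v\<close> in the
  differential.\<close>

lemma wirtinger_pair_cnj:
  assumes "wirtinger_pair f a b z"
  shows "wirtinger_pair (\<lambda>s. cnj (f s)) (cnj b) (cnj a) z"
  using has_derivative_cnj[OF assms[unfolded wirtinger_pair_def]]
  by (simp add: wirtinger_pair_def add.commute)

lemma wirtinger_pair_mult:
  assumes "wirtinger_pair f a b z" "wirtinger_pair g a' b' z"
  shows "wirtinger_pair (\<lambda>s. f s * g s) (a * g z + f z * a') (b * g z + f z * b') z"
  using has_derivative_mult[OF assms[unfolded wirtinger_pair_def]]
  by (simp add: wirtinger_pair_def algebra_simps)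

lemma wirtinger_pair_sum:
  assumes "\<And>i. i \<in> A \<Longrightarrow> wirtinger_pair (f i) (a i) (b i) z"
  shows "wirtinger_pair (\<lambda>s. \<Sum>i\<in>A. f i s) (\<Sum>i\<in>A. a i) (\<Sum>i\<in>A. b i) z"
  using has_derivative_sum[of A f "\<lambda>i v. a i * v + b i * cnj v" "at z"] assms
  by (simp add: wirtinger_pair_def sum.distrib sum_distrib_right)


subsection \<open>Differentiation under the integral sign\<close>

lemma set_integrable_continuous_compact:
  fixes f :: "'a::euclidean_space \<Rightarrow> 'b::{banach, second_countable_topology}"
  assumes "compact S" "continuous_on S f"
  shows "set_integrable lborel S f"
  unfolding set_integrable_def using assms by (rule borel_integrable_compact)

lemma exp_minus_one_minus_id_bound:
  fixes x :: real
  shows "\<bar>exp x - 1 - x\<bar> \<le> exp \<bar>x\<bar> * x\<^sup>2"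
  using Taylor_exp_field[of x 1] by (simp add: power2_eq_square algebra_simps)

text \<open>Writing \<open>Re (v * b z)\<close> as the mean of \<open>v * b z\<close> and its
  conjugate shows both coefficients. On a compact set the Taylor remainder of the exponential is
  quadratic in the increment, uniformly in \<open>z\<close>.\<close>

lemma wirtinger_pair_integral_exp:
  fixes G b :: "complex \<Rightarrow> complex"
  assumes D: "compact D" and G: "continuous_on D G" and b: "continuous_on D b"
  defines "E \<equiv> (\<lambda>s z. G z * of_real (exp (Re (s * b z))))"
  shows "wirtinger_pair (\<lambda>s. set_lebesgue_integral lborel D (E s))
           (set_lebesgue_integral lborel D (\<lambda>z. E s0 z * b z) / 2)
           (set_lebesgue_integral lborel D (\<lambda>z. E s0 z * cnj (b z)) / 2) s0"
proof -
  let ?I = "set_lebesgue_integral lborel D"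
  let ?J = "set_lebesgue_integral lborel D :: (complex \<Rightarrow> real) \<Rightarrow> real"
  obtain B where B: "\<And>z. z \<in> D \<Longrightarrow> cmod (b z) \<le> B" "B \<ge> 0"
  proof -
    have "bounded (b ` D)"
      using D b by (intro compact_imp_bounded compact_continuous_image)
    then obtain B where "\<forall>z\<in>D. cmod (b z) \<le> B"
      by (auto simp: bounded_iff)
    then show thesis
      by (intro that[of "max B 0"]) (auto intro: max.coboundedI1)
  qed
  have cont: "continuous_on D (E s)" for s
    unfolding E_def by (intro continuous_intros G b)
  note int = set_integrable_continuous_compact[OF D]
  \<comment> \<open>The constant of the quadratic remainder: for \<open>cmod (s - s0) < 1\<close>
    the exponent changes by at most \<open>B\<close>, so \<open>exp B * B\<^sup>2\<close> bounds the
    Taylor factor.\<close>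
  define C where "C = ?J (\<lambda>z. cmod (E s0 z)) * (exp B * B\<^sup>2)"
  define f' where "f' v = ?I (\<lambda>z. E s0 z * b z) / 2 * v + ?I (\<lambda>z. E s0 z * cnj (b z)) / 2 * cnj v" for v
  have f': "f' v = ?I (\<lambda>z. E s0 z * of_real (Re (v * b z)))" for v
  proof -
    have "?I (\<lambda>z. E s0 z * of_real (Re (v * b z)))
        = ?I (\<lambda>z. v / 2 * (E s0 z * b z) + cnj v / 2 * (E s0 z * cnj (b z)))"
      by (rule arg_cong[where f = ?I], rule ext) (simp add: complex_eq_iff field_simps)
    also have "\<dots> = ?I (\<lambda>z. v / 2 * (E s0 z * b z)) + ?I (\<lambda>z. cnj v / 2 * (E s0 z * cnj (b z)))"
      by (intro set_integral_add int continuous_intros cont b)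
    also have "\<dots> = v / 2 * ?I (\<lambda>z. E s0 z * b z) + cnj v / 2 * ?I (\<lambda>z. E s0 z * cnj (b z))"
      by (simp only: set_integral_mult_right)
    finally show ?thesis by (simp add: f'_def mult.commute)
  qed
  have bound: "cmod (?I (E s) - ?I (E s0) - f' (s - s0)) \<le> C * (cmod (s - s0))\<^sup>2"
    if s: "cmod (s - s0) < 1" for s
  proof -
    define x where "x z = Re ((s - s0) * b z)" for z
    have x_cont: "continuous_on D x"
      unfolding x_def by (intro continuous_intros b)
    have x_bound: "\<bar>exp (x z) - 1 - x z\<bar> \<le> exp B * B\<^sup>2 * (cmod (s - s0))\<^sup>2" if z: "z \<in> D" for z
    proof -
      have x1: "\<bar>x z\<bar> \<le> cmod (s - s0) * B"
        unfolding x_def using abs_Re_le_cmod[of "(s - s0) * b z"] B(1)[OF z]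
        by (smt (verit) mult_left_mono norm_ge_zero norm_mult)
      also have "\<dots> \<le> B"
        using s B(2) by (intro mult_left_le_one_le) auto
      finally have x2: "\<bar>x z\<bar> \<le> B" .
      have "(x z)\<^sup>2 \<le> (cmod (s - s0) * B)\<^sup>2"
        using x1 by (metis abs_ge_zero power2_abs power_mono)
      then have "exp \<bar>x z\<bar> * (x z)\<^sup>2 \<le> exp B * (cmod (s - s0) * B)\<^sup>2"
        using x2 by (intro mult_mono) auto
      then show ?thesis
        using exp_minus_one_minus_id_bound[of "x z"] by (simp add: power_mult_distrib algebra_simps)
    qed
    have "?I (E s) - ?I (E s0) - f' (s - s0) = ?I (\<lambda>z. E s z - E s0 z - E s0 z * of_real (x z))"
      unfolding f' x_def
      by (subst set_integral_diff, (intro int continuous_intros cont b)+)+ simp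
    also have "cmod \<dots> \<le> ?J (\<lambda>z. cmod (E s z - E s0 z - E s0 z * of_real (x z)))"
      by (rule set_integral_norm_bound, intro int continuous_intros cont x_cont)
    also have "\<dots> \<le> ?J (\<lambda>z. cmod (E s0 z) * (exp B * B\<^sup>2 * (cmod (s - s0))\<^sup>2))"
    proof (rule set_integral_mono)
      fix z assume z: "z \<in> D"
      \<comment> \<open>The increment of the exponent factors out, leaving exactly the remainder
        \<open>exp (x z) - 1 - x z\<close>.\<close>
      have "E s z = E s0 z * of_real (exp (x z))"
        by (simp add: E_def x_def mult_exp_exp[symmetric] algebra_simps flip: of_real_mult exp_add)
      then have "E s z - E s0 z - E s0 z * of_real (x z) = E s0 z * of_real (exp (x z) - 1 - x z)"
        by (simp add: algebra_simps)
      then show "cmod (E s z - E s0 z - E s0 z * of_real (x z))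
          \<le> cmod (E s0 z) * (exp B * B\<^sup>2 * (cmod (s - s0))\<^sup>2)"
        using x_bound[OF z] by (simp only: norm_mult norm_of_real mult_left_mono norm_ge_zero)
    qed (intro int continuous_intros cont x_cont)+
    also have "\<dots> = C * (cmod (s - s0))\<^sup>2"
      by (simp add: C_def)
    finally show ?thesis .
  qed
  have "((\<lambda>s. ?I (E s)) has_derivative f') (at s0)"
  proof (rule has_derivativeI_sandwich[where e = 1 and H = "\<lambda>s. C * cmod (s - s0)"])
    show "bounded_linear f'"
      unfolding f'_def
      by (intro bounded_linear_add bounded_linear_mult_right
          bounded_linear_compose[OF bounded_linear_mult_right bounded_linear_cnj])
    fix s assume "s \<noteq> s0" "dist s s0 < 1"
    then show "cmod (?I (E s) - ?I (E s0) - f' (s - s0)) / cmod (s - s0) \<le> C * cmod (s - s0)"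
      using bound[of s] by (simp add: dist_norm field_simps power2_eq_square)
  next
    show "((\<lambda>s. C * cmod (s - s0)) \<longlongrightarrow> 0) (at s0)"
      by (rule tendsto_eq_intros | simp)+
  qed simp
  then show ?thesis
    unfolding wirtinger_pair_def f'_def .
qed

subsection \<open>Orthogonal polynomials\<close>

text \<open>Successive removal of leading terms. Vanishing coefficients replace a degree bound so
  that \<open>n = 0\<close> correctly means \<open>f = 0\<close>.\<close>

lemma poly_triangular_expansion:
  fixes r :: "nat \<Rightarrow> 'a::field poly"
  assumes deg: "\<And>j i. i > j \<Longrightarrow> coeff (r j) i = 0" and lead: "\<And>j. coeff (r j) j \<noteq> 0"
    and f: "\<And>i. i \<ge> n \<Longrightarrow> coeff f i = 0"
  shows "\<exists>c. f = (\<Sum>j<n. smult (c j) (r j))"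
  using f
proof (induction n arbitrary: f)
  case 0
  then show ?case by (simp add: poly_eq_iff)
next
  case (Suc n)
  define a where "a = coeff f n / coeff (r n) n"
  have "coeff (f - smult a (r n)) i = 0" if "i \<ge> n" for i
    using that Suc.prems[of i] deg[of n i] lead[of n] by (cases "i = n") (auto simp: a_def)
  then obtain c where c: "f - smult a (r n) = (\<Sum>j<n. smult (c j) (r j))"
    using Suc.IH by blast
  have "(\<Sum>j<n. smult ((c(n := a)) j) (r j)) = (\<Sum>j<n. smult (c j) (r j))"
    by (rule sum.cong) auto
  then have "f = (\<Sum>j<Suc n. smult ((c(n := a)) j) (r j))"
    using c by (simp add: algebra_simps)
  then show ?case by blast
qed

text \<open>An explicit recursion for the monic orthogonal polynomials: it shows that the object
  behind \<open>THE\<close> exists, and later lets differentiability in the parameter be proved by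
  induction.\<close>

fun gram_schmidt :: "complex set \<Rightarrow> (complex \<Rightarrow> real) \<Rightarrow> nat \<Rightarrow> nat \<Rightarrow> complex poly" where
  "gram_schmidt D V N n = monom 1 n - (\<Sum>j<n.
     smult (poly_inner D V N (gram_schmidt D V N j) (monom 1 n)
       / poly_inner D V N (gram_schmidt D V N j) (gram_schmidt D V N j)) (gram_schmidt D V N j))"

declare gram_schmidt.simps [simp del]

lemma coeff_gram_schmidt_gt: "i > n \<Longrightarrow> coeff (gram_schmidt D V N n) i = 0"
  by (induction n arbitrary: i rule: less_induct)
    (subst gram_schmidt.simps, simp add: coeff_sum)

lemma coeff_gram_schmidt_same: "coeff (gram_schmidt D V N n) n = 1"
  by (subst gram_schmidt.simps) (simp add: coeff_sum coeff_gram_schmidt_gt)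

section \<open>The positive definite inner product of a weight on a compact set\<close>

locale weighted_domain =
  fixes D :: "complex set" and V :: "complex \<Rightarrow> real" and N :: nat
  assumes compact_D: "compact D" and interior_D: "interior D \<noteq> {}"
    and cont_V: "continuous_on D V"
begin

abbreviation inn :: "complex poly \<Rightarrow> complex poly \<Rightarrow> complex" where
  "inn \<equiv> poly_inner D V N"

lemma inner_integrable:
  "set_integrable lborel D (\<lambda>z. cnj (poly f z) * poly g z * of_real (exp (- real N * V z)))"
  by (intro set_integrable_continuous_compact compact_D continuous_intros cont_V)

lemma inner_cnj: "cnj (inn f g) = inn g f"
  unfolding poly_inner_def set_lebesgue_integral_def Bochner_Integration.integral_cnj[symmetric]
  by (simp add: mult.commute)

lemma inner_add_right: "inn f (g + h) = inn f g + inn f h"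
  using set_integral_add(2)[OF inner_integrable[of f g] inner_integrable[of f h]]
  by (simp add: poly_inner_def algebra_simps)

lemma inner_smult_right: "inn f (smult a g) = a * inn f g"
  by (simp add: poly_inner_def mult.left_commute mult.assoc flip: set_integral_mult_right)

lemma inner_zero_right [simp]: "inn f 0 = 0"
  by (simp add: poly_inner_def)

lemma inner_diff_right: "inn f (g - h) = inn f g - inn f h"
  using inner_add_right[of f "g - h" h] by simp

lemma inner_sum_right: "inn f (\<Sum>i\<in>A. g i) = (\<Sum>i\<in>A. inn f (g i))"
  by (induction A rule: infinite_finite_induct) (auto simp: inner_add_right)

lemma inner_add_left: "inn (f + g) h = inn f h + inn g h"
  by (metis inner_add_right inner_cnj complex_cnj_add)

lemma inner_diff_left: "inn (f - g) h = inn f h - inn g h"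
  by (metis inner_diff_right inner_cnj complex_cnj_diff)

lemma inner_smult_left: "inn (smult a f) g = cnj a * inn f g"
  by (metis inner_smult_right inner_cnj complex_cnj_mult)

lemma inner_sum_left: "inn (\<Sum>i\<in>A. g i) f = (\<Sum>i\<in>A. inn (g i) f)"
  by (subst inner_cnj[symmetric]) (simp add: inner_sum_right inner_cnj)

text \<open>The weight is positive and a nonzero polynomial has finitely many zeros, so a vanishing
  integral would make the nonempty open set \<open>interior D\<close> a null set.\<close>

lemma inner_self_pos:
  assumes "f \<noteq> 0"
  obtains r where "r > 0" "inn f f = of_real r"
proof -
  define g where "g z = (cmod (poly f z))\<^sup>2 * exp (- real N * V z)" for z
  define r where "r = set_lebesgue_integral lborel D g"
  have "cnj (poly f z) * poly f z * of_real (exp (- real N * V z)) = of_real (g z)" for z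
    by (simp add: g_def complex_norm_square[unfolded of_real_power] mult.commute)
  then have inn_eq: "inn f f = of_real r"
    by (simp only: poly_inner_def r_def set_integral_complex_of_real)
  have int: "integrable lborel (\<lambda>z. indicator D z *\<^sub>R g z)"
    unfolding g_def by (intro borel_integrable_compact compact_D continuous_intros cont_V)
  have "r \<ge> 0"
    unfolding r_def set_lebesgue_integral_def by (rule Bochner_Integration.integral_nonneg) (simp add: g_def)
  moreover have "r \<noteq> 0"
  proof
    assume "r = 0"
    then have "AE z in lborel. indicator D z *\<^sub>R g z = 0"
      using integral_nonneg_eq_0_iff_AE[OF int]
      by (simp add: r_def set_lebesgue_integral_def g_def)
    then have "AE z in lborel. z \<notin> D \<or> poly f z = 0"
      by (rule AE_mp) (auto simp: g_def indicator_def)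
    moreover have "AE z in lborel. z \<notin> {z. poly f z = 0}"
      by (intro AE_not_in finite_imp_null_set_lborel poly_roots_finite assms)
    ultimately have "AE z in lborel. z \<notin> interior D"
      by eventually_elim (use interior_subset in auto)
    then have "interior D \<in> null_sets lborel"
      by (subst (asm) AE_iff_null_sets[symmetric]) auto
    then have "negligible (interior D)"
      by (simp add: negligible_iff_null_sets null_sets_completionI)
    then show False
      using open_not_negligible[OF open_interior interior_D] by blast
  qed
  ultimately show thesis using that inn_eq by force
qed

lemma inner_self_eq_0D: "inn f f = 0 \<Longrightarrow> f = 0"
  using inner_self_pos[of f] by (metis less_irrefl of_real_eq_0_iff)

section \<open>Existence and uniqueness of the monic orthogonal polynomials\<close>

abbreviation gs :: "nat \<Rightarrow> complex poly" where
  "gs \<equiv> gram_schmidt D V N"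

lemma gs_nonzero: "gs n \<noteq> 0"
  using coeff_gram_schmidt_same[of D V N n] by force

lemma inner_gs_nonzero: "inn (gs n) (gs n) \<noteq> 0"
  using inner_self_eq_0D gs_nonzero by blast

text \<open>Of the subtracted projections only the one onto \<open>gs j\<close> survives, and it
  cancels \<open>inn (gs j) (monom 1 n)\<close>.\<close>

lemma inner_gs_less: "j < n \<Longrightarrow> inn (gs j) (gs n) = 0"
proof (induction n arbitrary: j rule: less_induct)
  case (less n)
  \<comment> \<open>The induction hypothesis covers pairs in increasing order; the other order
    follows by conjugation.\<close>
  have orth: "inn (gs j) (gs i) = 0" if "i < n" "i \<noteq> j" for i
    using less.IH[of i j] less.IH[of j i] that less.prems inner_cnj[of "gs i" "gs j"]
    by (cases i j rule: linorder_cases) auto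
  have "inn (gs j) (gs n) = inn (gs j) (monom 1 n)
      - (\<Sum>i<n. inn (gs i) (monom 1 n) / inn (gs i) (gs i) * inn (gs j) (gs i))"
    by (subst (2) gram_schmidt.simps) (simp add: inner_diff_right inner_sum_right inner_smult_right)
  also have "(\<Sum>i<n. inn (gs i) (monom 1 n) / inn (gs i) (gs i) * inn (gs j) (gs i))
      = (\<Sum>i<n. if i = j then inn (gs j) (monom 1 n) else 0)"
    by (rule sum.cong) (auto simp: orth inner_gs_nonzero)
  finally show ?case using less.prems by simp
qed

definition gs_norm :: "nat \<Rightarrow> real" where
  "gs_norm n = Re (inn (gs n) (gs n))"

lemma inner_gs_same: "inn (gs n) (gs n) = of_real (gs_norm n)"
  and gs_norm_pos: "gs_norm n > 0"
  using inner_self_pos[OF gs_nonzero[of n]] unfolding gs_norm_def by (metis Re_complex_of_real)+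

lemma is_monic_orth_gs: "is_monic_orth D V N gs gs_norm"
proof -
  have "degree (gs n) = n" for n
    by (intro antisym degree_le le_degree) (auto simp: coeff_gram_schmidt_gt coeff_gram_schmidt_same)
  moreover have "inn (gs m) (gs n) = (if m = n then of_real (gs_norm n) else 0)" for m n
    using inner_gs_less[of m n] inner_gs_less[of n m] inner_cnj[of "gs n" "gs m"] inner_gs_same
    by (cases m n rule: linorder_cases) auto
  ultimately show ?thesis
    by (simp add: is_monic_orth_def coeff_gram_schmidt_same gs_norm_pos)
qed

text \<open>A polynomial of degree below \<open>n\<close> is a combination of the \<open>p j\<close>
  with \<open>j < n\<close>.\<close>

lemma is_monic_orth_inner_low:
  assumes p: "is_monic_orth D V N p h" and f: "\<And>i. i \<ge> n \<Longrightarrow> coeff f i = 0"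
  shows "inn (p n) f = 0"
proof -
  have deg: "degree (p j) = j" and lead: "coeff (p j) j = 1" for j
    using p unfolding is_monic_orth_def by metis+
  obtain c where "f = (\<Sum>j<n. smult (c j) (p j))"
    using poly_triangular_expansion[of p n f] f deg lead by (metis coeff_eq_0 zero_neq_one)
  then show ?thesis
    using p by (simp add: inner_sum_right inner_smult_right is_monic_orth_def)
qed

text \<open>The difference of two monic polynomials of degree \<open>n\<close> has lower degree, so
  it is orthogonal to both of them and therefore to itself.\<close>

lemma is_monic_orth_unique:
  assumes p: "is_monic_orth D V N p h" and p': "is_monic_orth D V N p' h'"
  shows "p = p'" "h = h'"
proof -
  show eq: "p = p'"
  proof
    fix n
    have "coeff (p n - p' n) i = 0" if "i \<ge> n" for i
      using p p' that unfolding is_monic_orth_def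
      by (metis coeff_diff coeff_eq_0 diff_self le_neq_implies_less)
    then have "inn (p n - p' n) (p n - p' n) = 0"
      using is_monic_orth_inner_low[OF p] is_monic_orth_inner_low[OF p']
      by (simp add: inner_diff_left)
    then show "p n = p' n"
      using inner_self_eq_0D by fastforce
  qed
  show "h = h'"
  proof
    fix n
    have "inn (p n) (p n) = of_real (h n)" "inn (p' n) (p' n) = of_real (h' n)"
      using p p' unfolding is_monic_orth_def by simp_all
    then show "h n = h' n" by (simp add: eq)
  qed
qed

lemma monic_orth_eq: "monic_orth D V N = (gs, gs_norm)"
  unfolding monic_orth_def
  using is_monic_orth_gs is_monic_orth_unique by (intro the_equality) auto

section \<open>Orthonormal polynomials and expansions in them\<close>

abbreviation q :: "nat \<Rightarrow> complex poly" where
  "q \<equiv> orthonormal_poly D V N"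

lemma orthonormal_poly_eq: "q n = smult (of_real (1 / sqrt (gs_norm n))) (gs n)"
  by (simp add: orthonormal_poly_def monic_orth_eq)

lemma coeff_q_gt: "i > n \<Longrightarrow> coeff (q n) i = 0"
  by (simp add: orthonormal_poly_eq coeff_gram_schmidt_gt)

lemma coeff_q_same: "coeff (q n) n = of_real (1 / sqrt (gs_norm n))"
  by (simp add: orthonormal_poly_eq coeff_gram_schmidt_same)

lemma coeff_q_same_nonzero: "coeff (q n) n \<noteq> 0"
  using gs_norm_pos[of n] by (simp add: coeff_q_same)

lemma inner_q: "inn (q m) (q n) = (if m = n then 1 else 0)"
proof -
  have "complex_of_real (sqrt (gs_norm n)) * of_real (sqrt (gs_norm n)) = of_real (gs_norm n)"
    using gs_norm_pos[of n] by (simp flip: of_real_mult)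
  then show ?thesis
    using is_monic_orth_gs less_imp_neq[OF gs_norm_pos[of n]]
    by (simp add: orthonormal_poly_eq inner_smult_left inner_smult_right is_monic_orth_def)
qed

lemma q_expansion:
  assumes "\<And>i. i \<ge> n \<Longrightarrow> coeff f i = 0"
  shows "f = (\<Sum>j<n. smult (inn (q j) f) (q j))"
proof -
  obtain c where c: "f = (\<Sum>j<n. smult (c j) (q j))"
    using poly_triangular_expansion[of q n f] coeff_q_gt coeff_q_same_nonzero assms by blast
  have "inn (q j) f = c j" if "j < n" for j
    using that by (subst c) (simp add: inner_sum_right inner_smult_right inner_q if_distrib cong: if_cong)
  then have "(\<Sum>j<n. smult (inn (q j) f) (q j)) = (\<Sum>j<n. smult (c j) (q j))"
    by (intro sum.cong) auto
  then show ?thesis using c by simp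
qed

lemma inner_q_low: "(\<And>i. i \<ge> n \<Longrightarrow> coeff f i = 0) \<Longrightarrow> inn (q n) f = 0"
  using is_monic_orth_inner_low[OF is_monic_orth_gs, of n f]
  by (simp add: orthonormal_poly_eq inner_smult_left)

text \<open>Modulo a multiple of \<open>q n\<close> only lower degrees remain, and
  \<open>q n\<close> is orthogonal to those.\<close>

lemma inner_q_lead:
  assumes "\<And>i. i > n \<Longrightarrow> coeff f i = 0"
  shows "inn (q n) f = coeff f n / coeff (q n) n"
proof -
  define a where "a = coeff f n / coeff (q n) n"
  have "coeff (f - smult a (q n)) i = 0" if "i \<ge> n" for i
    using that assms coeff_q_gt coeff_q_same_nonzero[of n] by (cases "i = n") (auto simp: a_def)
  then have "inn (q n) (f - smult a (q n)) = 0"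
    by (rule inner_q_low)
  then show ?thesis
    by (simp add: inner_diff_right inner_smult_right inner_q a_def)
qed

text \<open>Insertion of the identity between two factors. As \<open>g\<close> is a polynomial, only
  finitely many terms are nonzero; the sum over all indices has the shape of
  \<open>mat_mul\<close>.\<close>

lemma inner_mult_expansion:
  "inn f (h * g) = (\<Sum>\<^sub>\<infinity>j\<in>UNIV. inn f (h * q j) * inn (q j) g)"
proof -
  define n where "n = Suc (degree g)"
  have g: "coeff g i = 0" if "i \<ge> n" for i
    using that by (simp add: n_def coeff_eq_0)
  have "g = (\<Sum>j<n. smult (inn (q j) g) (q j))"
    by (rule q_expansion) (rule g)
  then have "inn f (h * g) = inn f (h * (\<Sum>j<n. smult (inn (q j) g) (q j)))"
    by (rule arg_cong)
  also have "\<dots> = inn f (\<Sum>j<n. smult (inn (q j) g) (h * q j))"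
    by (simp add: sum_distrib_left)
  also have "\<dots> = (\<Sum>j<n. inn f (h * q j) * inn (q j) g)"
    by (simp add: inner_sum_right inner_smult_right mult.commute)
  also have "\<dots> = (\<Sum>\<^sub>\<infinity>j\<in>{..<n}. inn f (h * q j) * inn (q j) g)"
    by simp
  also have "\<dots> = (\<Sum>\<^sub>\<infinity>j\<in>UNIV. inn f (h * q j) * inn (q j) g)"
    by (rule infsum_cong_neutral) (auto intro!: inner_q_low g)
  finally show ?thesis .
qed

lemmas parseval = inner_mult_expansion[of _ 1, simplified]

section \<open>The matrix of multiplication by \<open>z\<close>, its powers and adjoints\<close>

abbreviation L :: cmat where
  "L \<equiv> mult_z_mat D V N"

lemma L_eq: "L m n = inn (q m) ([:0, 1:] * q n)"
  by (simp only: mult_z_mat_def)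

text \<open>Multiplication by \<open>z\<close> maps polynomials to polynomials, so composing
  operators is multiplying matrices: each product is collapsed by
  \<open>inner_mult_expansion\<close>.\<close>

lemma mat_pow_L: "mat_pow L k m n = inn (q m) ([:0, 1:] ^ k * q n)"
proof (induction k arbitrary: m n)
  case 0
  then show ?case by (simp add: inner_q)
next
  case (Suc k)
  have "mat_pow L (Suc k) m n
      = (\<Sum>\<^sub>\<infinity>j\<in>UNIV. inn (q m) ([:0, 1:] * q j) * inn (q j) ([:0, 1:] ^ k * q n))"
    unfolding mat_pow.simps mat_mul_def Suc by (simp only: L_eq)
  also have "\<dots> = inn (q m) ([:0, 1:] ^ Suc k * q n)"
    by (simp only: inner_mult_expansion[symmetric] power_Suc mult.assoc)
  finally show ?case .
qed

text \<open>Adjunction reverses the order of factors, which is harmless for powers of a single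
  matrix.\<close>

lemma mat_pow_adj_L: "mat_pow (adj L) k = adj (mat_pow L k)"
proof (induction k)
  case 0
  then show ?case by (auto simp: adj_def fun_eq_iff)
next
  case (Suc k)
  have "mat_pow (adj L) (Suc k) m n = adj (mat_pow L (Suc k)) m n" for m n
  proof -
    have "mat_pow (adj L) (Suc k) m n
        = cnj (\<Sum>\<^sub>\<infinity>j\<in>UNIV. inn (q n) ([:0, 1:] ^ k * q j) * inn (q j) ([:0, 1:] * q m))"
      unfolding mat_pow.simps Suc mat_mul_def adj_def mat_pow_L L_eq infsum_cnj[symmetric]
      by (simp only: complex_cnj_mult mult.commute)
    also have "\<dots> = cnj (mat_pow L (Suc k) n m)"
      unfolding mat_pow_L inner_mult_expansion[symmetric] by (simp only: power_Suc2 mult.assoc)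
    finally show ?thesis by (simp only: adj_def)
  qed
  then show ?case by blast
qed

text \<open>Adjunction exchanges the strict triangles, maps the diagonal to itself and fixes the
  real factor \<open>1/2\<close>.\<close>

lemma M_star_mat_L: "M_star_mat L k = adj (M_mat L k)"
  by (auto simp: fun_eq_iff M_star_mat_def M_mat_def mat_pow_adj_L adj_def mat_add_def
      mat_scale_def upper_part_def lower_part_def diag_part_def)

end

subsection \<open>Deformation of the orthonormal polynomials\<close>

text \<open>The degree bound is demanded for every \<open>s\<close>, so that inner products of such
  families are sums over monomials of a fixed finite length.\<close>

definition poly_wirtinger ::
    "(complex \<Rightarrow> complex poly) \<Rightarrow> complex poly \<Rightarrow> complex poly \<Rightarrow> complex \<Rightarrow> nat \<Rightarrow> bool" where
  "poly_wirtinger F P P' s0 n \<longleftrightarrow>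
     (\<forall>s. \<forall>i>n. coeff (F s) i = 0) \<and>
     (\<forall>i. wirtinger_pair (\<lambda>s. coeff (F s) i) (coeff P i) (coeff P' i) s0)"

lemma poly_wirtinger_coeff_gt:
  assumes "poly_wirtinger F P P' s0 n" "i > n"
  shows "coeff P i = 0" "coeff P' i = 0"
proof -
  have "wirtinger_pair (\<lambda>s. coeff (F s) i) (coeff P i) (coeff P' i) s0"
    using assms unfolding poly_wirtinger_def by blast
  moreover have "coeff (F s) i = 0" for s
    using assms unfolding poly_wirtinger_def by blast
  ultimately have "wirtinger_pair (\<lambda>s. 0) (coeff P i) (coeff P' i) s0"
    by simp
  then show "coeff P i = 0" "coeff P' i = 0"
    using wirtinger_pair_unique[OF _ wirtinger_pair_const[of 0 s0]] by simp_all
qed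

lemma poly_wirtinger_exists:
  assumes deg: "\<And>s i. i > n \<Longrightarrow> coeff (F s) i = 0"
    and diff: "\<And>i. (\<lambda>s. coeff (F s) i) differentiable at s0"
  shows "\<exists>P P'. poly_wirtinger F P P' s0 n"
proof -
  obtain a b where ab: "\<And>i. wirtinger_pair (\<lambda>s. coeff (F s) i) (a i) (b i) s0"
    using differentiable_imp_wirtinger_pair[OF diff] by metis
  have zero: "a i = 0" "b i = 0" if "i > n" for i
  proof -
    have "wirtinger_pair (\<lambda>s. 0) (a i) (b i) s0"
      using ab[of i] deg[OF that] by simp
    then show "a i = 0" "b i = 0"
      using wirtinger_pair_unique[OF _ wirtinger_pair_const[of 0 s0]] by simp_all
  qed
  \<comment> \<open>Derivatives of coefficients beyond \<open>n\<close> vanish, so the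
    coefficientwise derivatives do form polynomials.\<close>
  have "coeff (\<Sum>j\<le>n. monom (c j) j) i = c i" if "\<And>i. i > n \<Longrightarrow> c i = 0" for c :: "nat \<Rightarrow> complex" and i
    using that[of i] by (simp add: coeff_sum)
  then have "poly_wirtinger F (\<Sum>j\<le>n. monom (a j) j) (\<Sum>j\<le>n. monom (b j) j) s0 n"
    using ab zero deg by (simp add: poly_wirtinger_def)
  then show ?thesis by blast
qed

lemma poly_wirtinger_mult_X:
  assumes "poly_wirtinger F P P' s0 n"
  shows "poly_wirtinger (\<lambda>s. [:0, 1:] * F s) ([:0, 1:] * P) ([:0, 1:] * P') s0 (Suc n)"
  using assms
  by (auto simp: poly_wirtinger_def coeff_pCons wirtinger_pair_const split: nat.split)

text \<open>Separates the two sources of parameter dependence, coefficients and moments of the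
  weight. The factors \<open>h\<close> and \<open>h'\<close> accommodate the power of
  \<open>z\<close> produced by differentiating the weight.\<close>

lemma (in weighted_domain) inner_mult_coeffs:
  assumes f: "\<And>i. i > n \<Longrightarrow> coeff f i = 0" and g: "\<And>i. i > m \<Longrightarrow> coeff g i = 0"
  shows "inn (h * f) (h' * g)
    = (\<Sum>i\<le>n. \<Sum>j\<le>m. cnj (coeff f i) * coeff g j * inn (h * monom 1 i) (h' * monom 1 j))"
proof -
  have "degree f \<le> n" "degree g \<le> m"
    using f g by (auto intro: degree_le)
  then have "f = (\<Sum>i\<le>n. smult (coeff f i) (monom 1 i))" "g = (\<Sum>j\<le>m. smult (coeff g j) (monom 1 j))"
    by (simp_all add: smult_monom poly_as_sum_of_monoms')
  from arg_cong2[OF this, of "\<lambda>f g. inn (h * f) (h' * g)"]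
  have "inn (h * f) (h' * g) = inn (h * (\<Sum>i\<le>n. smult (coeff f i) (monom 1 i)))
      (h' * (\<Sum>j\<le>m. smult (coeff g j) (monom 1 j)))" .
  also have "\<dots> = inn (\<Sum>i\<le>n. smult (coeff f i) (h * monom 1 i)) (\<Sum>j\<le>m. smult (coeff g j) (h' * monom 1 j))"
    by (simp add: sum_distrib_left)
  also have "\<dots> = (\<Sum>i\<le>n. \<Sum>j\<le>m. cnj (coeff f i) * coeff g j * inn (h * monom 1 i) (h' * monom 1 j))"
    by (subst sum.swap) (simp add: inner_sum_left inner_smult_left inner_sum_right inner_smult_right
        sum_distrib_left mult_ac)
  finally show ?thesis .
qed

text \<open>Isolates what the deformation argument uses of the potential: differentiating the weight
  inserts \<open>z\<^sup>k\<close> in the right argument, or in the left one for the conjugate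
  derivative.\<close>

locale deformed_weight =
  fixes D :: "complex set" and W :: "complex \<Rightarrow> complex \<Rightarrow> real" and N k :: nat and c :: real
  assumes weighted_domain: "weighted_domain D (W s)"
    and inner_wirtinger: "wirtinger_pair (\<lambda>s. poly_inner D (W s) N f g)
      (of_real c * poly_inner D (W s0) N f ([:0, 1:] ^ k * g))
      (of_real c * poly_inner D (W s0) N ([:0, 1:] ^ k * f) g) s0"
begin

sublocale weighted_domain D "W s" N for s
  by (rule weighted_domain)

abbreviation inner_at :: "complex \<Rightarrow> complex poly \<Rightarrow> complex poly \<Rightarrow> complex" where
  "inner_at s \<equiv> poly_inner D (W s) N"

text \<open>Product rule with three contributions: left polynomial, right polynomial and weight.
  Antilinearity in the left argument makes \<open>P'\<close> appear together with \<open>Q\<close>,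
  and \<open>P\<close> with \<open>Q'\<close>.\<close>

lemma inner_family_wirtinger:
  assumes F: "poly_wirtinger F P P' s0 n" and G: "poly_wirtinger G Q Q' s0 m"
  shows "wirtinger_pair (\<lambda>s. inner_at s (F s) (G s))
    (inner_at s0 P' (G s0) + inner_at s0 (F s0) Q + of_real c * inner_at s0 (F s0) ([:0, 1:] ^ k * G s0))
    (inner_at s0 P (G s0) + inner_at s0 (F s0) Q' + of_real c * inner_at s0 ([:0, 1:] ^ k * F s0) (G s0)) s0"
proof -
  let ?X = "[:0, 1:] ^ k :: complex poly"
  let ?J = "\<lambda>s i j. inner_at s (monom 1 i) (monom 1 j)"
  have wF: "wirtinger_pair (\<lambda>s. cnj (coeff (F s) i)) (cnj (coeff P' i)) (cnj (coeff P i)) s0" for i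
    using F by (simp add: poly_wirtinger_def wirtinger_pair_cnj)
  have wG: "wirtinger_pair (\<lambda>s. coeff (G s) i) (coeff Q i) (coeff Q' i) s0" for i
    using G by (simp add: poly_wirtinger_def)
  have dF: "i > n \<Longrightarrow> coeff (F s) i = 0" and dG: "i > m \<Longrightarrow> coeff (G s) i = 0" for s i
    using F G by (simp_all add: poly_wirtinger_def)
  note dP = poly_wirtinger_coeff_gt[OF F] and dQ = poly_wirtinger_coeff_gt[OF G]
  let ?f = "\<lambda>i. cnj (coeff (F s0) i)" and ?g = "coeff (G s0)"
  have w: "wirtinger_pair (\<lambda>s. \<Sum>i\<le>n. \<Sum>j\<le>m. cnj (coeff (F s) i) * coeff (G s) j * ?J s i j)
    (\<Sum>i\<le>n. \<Sum>j\<le>m. (cnj (coeff P' i) * ?g j + ?f i * coeff Q j) * ?J s0 i j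
      + ?f i * ?g j * (of_real c * inner_at s0 (monom 1 i) (?X * monom 1 j)))
    (\<Sum>i\<le>n. \<Sum>j\<le>m. (cnj (coeff P i) * ?g j + ?f i * coeff Q' j) * ?J s0 i j
      + ?f i * ?g j * (of_real c * inner_at s0 (?X * monom 1 i) (monom 1 j))) s0"
    by (intro wirtinger_pair_sum wirtinger_pair_mult wF wG inner_wirtinger)
  note plain = inner_mult_coeffs[where h = 1 and h' = 1, unfolded mult_1_left]
  have eqs:
    "\<And>s. inner_at s (F s) (G s) = (\<Sum>i\<le>n. \<Sum>j\<le>m. cnj (coeff (F s) i) * coeff (G s) j * ?J s i j)"
    "inner_at s0 P' (G s0) = (\<Sum>i\<le>n. \<Sum>j\<le>m. cnj (coeff P' i) * ?g j * ?J s0 i j)"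
    "inner_at s0 P (G s0) = (\<Sum>i\<le>n. \<Sum>j\<le>m. cnj (coeff P i) * ?g j * ?J s0 i j)"
    "inner_at s0 (F s0) Q = (\<Sum>i\<le>n. \<Sum>j\<le>m. ?f i * coeff Q j * ?J s0 i j)"
    "inner_at s0 (F s0) Q' = (\<Sum>i\<le>n. \<Sum>j\<le>m. ?f i * coeff Q' j * ?J s0 i j)"
    by (rule plain; simp add: dF dG dP dQ)+
  have eqs_X:
    "inner_at s0 (F s0) (?X * G s0)
      = (\<Sum>i\<le>n. \<Sum>j\<le>m. ?f i * ?g j * inner_at s0 (monom 1 i) (?X * monom 1 j))"
    "inner_at s0 (?X * F s0) (G s0)
      = (\<Sum>i\<le>n. \<Sum>j\<le>m. ?f i * ?g j * inner_at s0 (?X * monom 1 i) (monom 1 j))"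
    using inner_mult_coeffs[of n "F s0" m "G s0" s0 1 ?X] inner_mult_coeffs[of n "F s0" m "G s0" s0 ?X 1]
    by (simp_all add: dF dG)
  show ?thesis
    unfolding eqs eqs_X sum_distrib_left sum.distrib[symmetric]
    using w by (simp add: algebra_simps)
qed

section \<open>Differentiability of the orthogonal polynomials in the parameter\<close>

lemma inner_family_differentiable:
  assumes "\<And>s i. i > n \<Longrightarrow> coeff (F s) i = 0" "\<And>i. (\<lambda>s. coeff (F s) i) differentiable at s0"
    and "\<And>s i. i > m \<Longrightarrow> coeff (G s) i = 0" "\<And>i. (\<lambda>s. coeff (G s) i) differentiable at s0"
  shows "(\<lambda>s. inner_at s (F s) (G s)) differentiable at s0"
proof -
  obtain P P' Q Q' where "poly_wirtinger F P P' s0 n" "poly_wirtinger G Q Q' s0 m"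
    using poly_wirtinger_exists[OF assms(1,2)] poly_wirtinger_exists[OF assms(3,4)] by blast
  then show ?thesis
    by (rule wirtinger_pair_imp_differentiable[OF inner_family_wirtinger])
qed

text \<open>Induction along the recursion: its coefficients are quotients of inner products of
  earlier families, with nonvanishing denominators.\<close>

lemma gs_differentiable: "(\<lambda>s. coeff (gram_schmidt D (W s) N n) i) differentiable at s0"
proof (induction n arbitrary: i rule: less_induct)
  case (less n)
  have "(\<lambda>s. inner_at s (gs s j) (monom 1 n) / inner_at s (gs s j) (gs s j) * coeff (gs s j) i)
      differentiable at s0" if "j < n" for j
  proof (intro differentiable_mult differentiable_divide inner_gs_nonzero less.IH[OF that])
    show "(\<lambda>s. inner_at s (gs s j) (monom 1 n)) differentiable at s0"
      by (rule inner_family_differentiable[of j _ _ n])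
        (simp_all add: coeff_gram_schmidt_gt less.IH[OF that])
    show "(\<lambda>s. inner_at s (gs s j) (gs s j)) differentiable at s0"
      by (rule inner_family_differentiable[of j _ _ j])
        (simp_all add: coeff_gram_schmidt_gt less.IH[OF that])
  qed
  then have "(\<lambda>s. coeff (monom 1 n) i - (\<Sum>j<n. inner_at s (gs s j) (monom 1 n)
      / inner_at s (gs s j) (gs s j) * coeff (gs s j) i)) differentiable at s0"
    by (intro differentiable_diff differentiable_const differentiable_sum) auto
  then show ?case
    by (subst gram_schmidt.simps) (simp add: coeff_sum)
qed

text \<open>Normalisation divides by the square root of \<open>gs_norm\<close>, which is positive
  and, as the real part of an inner product, differentiable.\<close>

lemma q_differentiable: "(\<lambda>s. coeff (orthonormal_poly D (W s) N n) i) differentiable at s0"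
proof -
  have "(\<lambda>s. inner_at s (gs s n) (gs s n)) differentiable at s0"
    by (rule inner_family_differentiable[of n _ _ n]) (auto simp: coeff_gram_schmidt_gt gs_differentiable)
  then obtain f' where "((\<lambda>s. inner_at s (gs s n) (gs s n)) has_derivative f') (at s0)"
    by (auto simp: differentiable_def)
  from has_derivative_Re[OF this]
  have "((\<lambda>s. gs_norm s n) has_derivative (\<lambda>v. Re (f' v))) (at s0)"
    by (simp add: gs_norm_def)
  note der = has_derivative_of_real[OF has_derivative_divide'[OF has_derivative_const[of 1]
        has_derivative_real_sqrt[OF gs_norm_pos this]]]
  have "(\<lambda>s. complex_of_real (1 / sqrt (gs_norm s n))) differentiable at s0"
    using der gs_norm_pos[of s0 n] unfolding differentiable_def by (metis less_imp_neq real_sqrt_eq_zero_cancel_iff)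
  then show ?thesis
    unfolding orthonormal_poly_eq coeff_smult by (intro differentiable_mult gs_differentiable)
qed

text \<open>Both derivatives are treated together, since orthonormality couples \<open>P\<close>
  with \<open>P'\<close>.\<close>

lemma toda_equations:
  fixes s0 :: complex
  defines "M \<equiv> M_mat (L s0) k" and "Ms \<equiv> M_star_mat (L s0) k"
  shows "wirtinger_pair (\<lambda>s. L s m n) (of_real c * commutator (L s0) M m n)
    (of_real c * commutator Ms (L s0) m n) s0"
proof -
  let ?X = "[:0, 1:] :: complex poly"
  let ?I = "inner_at s0" and ?q = "q s0"
  have "\<exists>P P'. poly_wirtinger (\<lambda>s. q s n) P P' s0 n" for n
    by (rule poly_wirtinger_exists) (auto simp: coeff_q_gt q_differentiable)
  then obtain P P' where P: "\<And>n. poly_wirtinger (\<lambda>s. q s n) (P n) (P' n) s0 n"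
    by metis
  define A where "A m n = ?I (?q m) (P n)" for m n
  define B where "B m n = ?I (?q m) (P' n)" for m n
  \<comment> \<open>Differentiation in the parameter does not raise the degree in \<open>z\<close>,
    so the expansions of \<open>P n\<close> and \<open>P' n\<close> stop at
    \<open>n\<close>.\<close>
  have upper: "A m n = 0" "B m n = 0" if "m > n" for m n
    unfolding A_def B_def
    by (rule inner_q_low, use that poly_wirtinger_coeff_gt[OF P] in force)+
  \<comment> \<open>The leading coefficient is real for every \<open>s\<close>, so its two Wirtinger
    derivatives are conjugate; the diagonal entries are these derivatives divided by that real
    coefficient.\<close>
  have diag: "B n n = cnj (A n n)" for n
  proof -
    have w: "wirtinger_pair (\<lambda>s. coeff (q s n) n) (coeff (P n) n) (coeff (P' n) n) s0"
      using P by (simp add: poly_wirtinger_def)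
    have "cnj (coeff (q s n) n) = coeff (q s n) n" for s
      by (simp add: coeff_q_same)
    then have "coeff (P' n) n = cnj (coeff (P n) n)"
      using wirtinger_pair_unique(2)[OF w] wirtinger_pair_cnj[OF w] by simp
    then show ?thesis
      using inner_q_lead[of n "P n" s0] inner_q_lead[of n "P' n" s0] poly_wirtinger_coeff_gt[OF P]
      by (simp add: A_def B_def coeff_q_same)
  qed
  \<comment> \<open>The products \<open>(q\<^sub>m, q\<^sub>n)\<close> are constant in
    \<open>s\<close>, so the three contributions add up to zero.\<close>
  have orth: "cnj (B n m) + A m n + of_real c * mat_pow (L s0) k m n = 0" for m n
  proof -
    have "wirtinger_pair (\<lambda>s. inner_at s (q s m) (q s n))
      (?I (P' m) (?q n) + ?I (?q m) (P n) + of_real c * ?I (?q m) (?X ^ k * ?q n))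
      (?I (P m) (?q n) + ?I (?q m) (P' n) + of_real c * ?I (?X ^ k * ?q m) (?q n)) s0"
      by (rule inner_family_wirtinger) (rule P)+
    then have "?I (P' m) (?q n) + ?I (?q m) (P n) + of_real c * ?I (?q m) (?X ^ k * ?q n) = 0"
      unfolding inner_q by (rule wirtinger_pair_unique(1)) (rule wirtinger_pair_const)
    then show ?thesis
      by (simp only: A_def B_def inner_cnj mat_pow_L)
  qed
  have M_eq: "M m n = (if m > n then mat_pow (L s0) k m n
      else if m = n then mat_pow (L s0) k m n / 2 else 0)" for m n
    by (simp add: M_def M_mat_def mat_add_def lower_part_def diag_part_def mat_scale_def)
  \<comment> \<open>Below the diagonal \<open>A\<close> vanishes and above it
    \<open>cnj (B n m)\<close> does; on the diagonal the two agree, which is the origin of the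
    factor \<open>1/2\<close>.\<close>
  have B_M: "cnj (B n m) = - of_real c * M m n" for m n
    using orth[of n m] upper diag[of n] unfolding M_eq
    by (cases m n rule: linorder_cases) (auto simp: field_simps add_eq_0_iff)
  have A_M: "A m n + of_real c * mat_pow (L s0) k m n = of_real c * M m n" for m n
    using orth[of n m] B_M[of n m] by (simp add: algebra_simps add_eq_0_iff)
  \<comment> \<open>Joins the derivative of the polynomial with that of the weight; its components
    are those of \<open>of_real c * M m n\<close>, so the weight term need not be expanded
    separately.\<close>
  define R where "R n = P n + smult (of_real c) (?X ^ k * ?q n)" for n
  have R: "?I (?q m) (R n) = of_real c * M m n" for m n
    using A_M[of m n] by (simp add: R_def A_def inner_add_right inner_smult_right mat_pow_L)
  have Ms_eq: "Ms m n = cnj (M n m)" for m n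
    by (simp add: Ms_def M_def M_star_mat_L adj_def)
  have w: "wirtinger_pair (\<lambda>s. L s m n)
     (?I (P' m) (?X * ?q n) + ?I (?q m) (?X * P n) + of_real c * ?I (?q m) (?X ^ k * (?X * ?q n)))
     (?I (P m) (?X * ?q n) + ?I (?q m) (?X * P' n) + of_real c * ?I (?X ^ k * ?q m) (?X * ?q n)) s0"
    unfolding L_eq by (rule inner_family_wirtinger[OF P poly_wirtinger_mult_X[OF P]])
  \<comment> \<open>Since \<open>z\<^sup>k\<close> and \<open>z\<close> commute, the weight term
    merges into \<open>R n\<close>. The first remaining product then yields \<open>- c\<close> times
    \<open>mat_mul M L\<close>, the second \<open>c\<close> times \<open>mat_mul L M\<close>, with
    \<open>L\<close> taken at \<open>s0\<close>.\<close>
  have "?I (P' m) (?X * ?q n) + ?I (?q m) (?X * P n) + of_real c * ?I (?q m) (?X ^ k * (?X * ?q n))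
      = ?I (P' m) (?X * ?q n) + ?I (?q m) (?X * R n)"
    unfolding R_def distrib_left mult_smult_right inner_add_right inner_smult_right
    by (simp only: mult.left_commute[of ?X] add.assoc)
  also have "\<dots> = (\<Sum>\<^sub>\<infinity>j\<in>UNIV. of_real (- c) * (M m j * L s0 j n))
      + (\<Sum>\<^sub>\<infinity>j\<in>UNIV. of_real c * (L s0 m j * M j n))"
  proof -
    have "?I (P' m) (?q j) = of_real (- c) * M m j" for j
      using B_M[of j m] by (simp add: B_def inner_cnj)
    then show ?thesis
      unfolding parseval[of s0 "P' m" "?X * ?q n"] inner_mult_expansion[of s0 "?q m" ?X "R n"]
        R L_eq[symmetric]
      by (simp only: mult_ac)
  qed
  also have "\<dots> = of_real c * commutator (L s0) M m n"
    by (simp only: infsum_cmult_right' commutator_def mat_mul_def) (simp add: algebra_simps)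
  finally have 1: "?I (P' m) (?X * ?q n) + ?I (?q m) (?X * P n)
      + of_real c * ?I (?q m) (?X ^ k * (?X * ?q n)) = of_real c * commutator (L s0) M m n" .
  \<comment> \<open>Here the weight term sits in the left argument and merges into
    \<open>R m\<close>; \<open>c\<close> is real and survives the antilinearity there.\<close>
  have "?I (P m) (?X * ?q n) + ?I (?q m) (?X * P' n) + of_real c * ?I (?X ^ k * ?q m) (?X * ?q n)
      = ?I (R m) (?X * ?q n) + ?I (?q m) (?X * P' n)"
    by (simp add: R_def inner_add_left inner_smult_left)
  also have "\<dots> = (\<Sum>\<^sub>\<infinity>j\<in>UNIV. of_real c * (Ms m j * L s0 j n))
      + (\<Sum>\<^sub>\<infinity>j\<in>UNIV. of_real (- c) * (L s0 m j * Ms j n))"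
  proof -
    have "B j n = of_real (- c) * Ms j n" for j
      using arg_cong[OF B_M[of j n], of cnj] by (simp add: Ms_eq)
    moreover have "?I (R m) (?q j) = of_real c * Ms m j" for j
      by (subst inner_cnj[symmetric]) (simp add: R Ms_eq)
    ultimately show ?thesis
      unfolding parseval[of s0 "R m" "?X * ?q n"] inner_mult_expansion[of s0 "?q m" ?X "P' n"]
        B_def[symmetric] L_eq[symmetric]
      by (simp only: mult_ac)
  qed
  also have "\<dots> = of_real c * commutator Ms (L s0) m n"
    by (simp only: infsum_cmult_right' commutator_def mat_mul_def) (simp add: algebra_simps)
  finally show ?thesis
    using w by (simp only: 1)
qed

end

section \<open>Adjoint equations and application to the given potential\<close>

lemma commutator_adj: "commutator (adj A) (adj B) m n = cnj (commutator B A n m)"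
  by (simp add: commutator_def mat_mul_def adj_def mult.commute flip: infsum_cnj)

text \<open>Only the \<open>k\<close>-th term of the potential involves \<open>s\<close>, so the
  weight is a fixed factor times \<open>exp (Re (s * b z))\<close>, to which differentiation under
  the integral applies.\<close>

lemma deformed_weight_pot_V:
  assumes D: "compact D" "interior D \<noteq> {}" and k: "k \<in> {1..d+1}"
  shows "deformed_weight D (\<lambda>s. pot_V d t0 (t(k := s))) N k (real N / t0)"
proof -
  let ?W = "\<lambda>s. pot_V d t0 (t(k := s))" and ?c = "real N / t0"
  show ?thesis
  proof
    show "compact D" "interior D \<noteq> {}"
      by (rule D)+
    show "continuous_on D (?W s)" for s
      unfolding pot_V_def pot_U_def divide_inverse by (intro continuous_intros)
  next
    fix f g s0
    define W0 where "W0 = ?W 0"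
    have W0_cont: "continuous_on D W0"
      unfolding W0_def pot_V_def pot_U_def divide_inverse by (intro continuous_intros)
    \<comment> \<open>The \<open>2\<close> stems from \<open>2 * Re\<close> in the potential and is
      cancelled by the halves in the derivatives of the integral.\<close>
    define b where "b z = of_real (2 * ?c) * z ^ k" for z :: complex
    define G where "G z = cnj (poly f z) * poly g z * of_real (exp (- real N * W0 z))" for z
    have W: "- real N * ?W s z = - real N * W0 z + Re (s * b z)" for s z
    proof -
      have "(\<Sum>i=1..d+1. (t(k := s)) i * z ^ i) = s * z ^ k + (\<Sum>i=1..d+1. (t(k := 0)) i * z ^ i)"
      proof -
        have split: "(\<Sum>i=1..d+1. u i * z ^ i) = u k * z ^ k + (\<Sum>i\<in>{1..d+1} - {k}. u i * z ^ i)"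
          for u :: "nat \<Rightarrow> complex"
          by (rule sum.remove) (use k in auto)
        have "(\<Sum>i\<in>{1..d+1} - {k}. (t(k := s)) i * z ^ i) = (\<Sum>i\<in>{1..d+1} - {k}. (t(k := 0)) i * z ^ i)"
          by (rule sum.cong) auto
        then show ?thesis
          unfolding split by simp
      qed
      then have "pot_U d (t(k := s)) z = pot_U d (t(k := 0)) z - 2 * Re (s * z ^ k)"
        by (simp add: pot_U_def)
      moreover have "Re (s * b z) = 2 * ?c * Re (s * z ^ k)"
        by (simp add: b_def algebra_simps diff_divide_distrib)
      ultimately show ?thesis
        unfolding pot_V_def W0_def
        by (simp only:) (simp add: diff_divide_distrib right_diff_distrib mult.left_commute mult.assoc)
    qed
    have E: "cnj (poly f z) * poly g z * of_real (exp (- real N * ?W s z))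
        = G z * of_real (exp (Re (s * b z)))" for s z
      unfolding W exp_add G_def by simp
    have "wirtinger_pair (\<lambda>s. set_lebesgue_integral lborel D (\<lambda>z. G z * of_real (exp (Re (s * b z)))))
      (set_lebesgue_integral lborel D (\<lambda>z. G z * of_real (exp (Re (s0 * b z))) * b z) / 2)
      (set_lebesgue_integral lborel D (\<lambda>z. G z * of_real (exp (Re (s0 * b z))) * cnj (b z)) / 2) s0"
      unfolding G_def b_def
      by (intro wirtinger_pair_integral_exp D continuous_intros W0_cont)
    moreover have "set_lebesgue_integral lborel D (\<lambda>z. G z * of_real (exp (Re (s0 * b z))) * b z) / 2
        = of_real ?c * poly_inner D (?W s0) N f ([:0, 1:] ^ k * g)"
      unfolding E[symmetric] poly_inner_def set_integral_mult_right[symmetric] set_integral_divide_zero[symmetric]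
      by (rule arg_cong[where f = "set_lebesgue_integral lborel D"], rule ext)
        (simp add: b_def poly_power mult_ac)
    moreover have "set_lebesgue_integral lborel D (\<lambda>z. G z * of_real (exp (Re (s0 * b z))) * cnj (b z)) / 2
        = of_real ?c * poly_inner D (?W s0) N ([:0, 1:] ^ k * f) g"
      unfolding E[symmetric] poly_inner_def set_integral_mult_right[symmetric] set_integral_divide_zero[symmetric]
      by (rule arg_cong[where f = "set_lebesgue_integral lborel D"], rule ext)
        (simp add: b_def poly_power mult_ac)
    ultimately show "wirtinger_pair (\<lambda>s. poly_inner D (?W s) N f g)
        (of_real ?c * poly_inner D (?W s0) N f ([:0, 1:] ^ k * g))
        (of_real ?c * poly_inner D (?W s0) N ([:0, 1:] ^ k * f) g) s0"
      by (simp only: poly_inner_def[of D _ N f g] E)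
  qed
qed

theorem proposition5p9:
  fixes d :: nat and t :: "nat \<Rightarrow> complex" and D :: "complex set"
  assumes "d \<ge> 1"
    and "t 1 = 0"
    and "cmod (t 2) < 1 / 2"
    and "\<And>k. k > d + 1 \<Longrightarrow> t k = 0"
    and "compact_C2_domain D"
    and "0 \<in> interior D"
    and "\<And>z. z \<in> D - {0} \<Longrightarrow> pot_U d t z > 0"
  shows "\<exists>\<tau>>0. \<forall>t0::real. 0 < t0 \<and> t0 < \<tau> \<longrightarrow>
    (\<forall>N::nat. N \<ge> 1 \<longrightarrow> (\<forall>k\<in>{1..d+1}.
      let Lfun = (\<lambda>s. mult_z_mat D (pot_V d t0 (t(k := s))) N);
          L = mult_z_mat D (pot_V d t0 t) N;
          M = M_mat L k;
          Mstar = M_star_mat L k;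
          c = complex_of_real (real N / t0)
      in mat_has_wirtinger Lfun (mat_scale c (commutator L M)) (t k)
       \<and> mat_has_wirtinger (\<lambda>s. adj (Lfun s)) (mat_scale c (commutator (adj L) M)) (t k)
       \<and> mat_has_wirtinger_bar Lfun (mat_scale c (commutator Mstar L)) (t k)
       \<and> mat_has_wirtinger_bar (\<lambda>s. adj (Lfun s)) (mat_scale c (commutator Mstar (adj L))) (t k)))"
proof (intro exI[of _ "1::real"] conjI allI impI ballI)
  fix t0 :: real and N k :: nat
  assume k: "k \<in> {1..d+1}"
  define Lfun where "Lfun s = mult_z_mat D (pot_V d t0 (t(k := s))) N" for s
  define L where "L = Lfun (t k)"
  define c where "c = real N / t0"
  \<comment> \<open>The origin is an interior point, so the interior is nonempty; this makes the
    inner product definite.\<close>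
  have "compact D" "interior D \<noteq> {}"
    using assms(5,6) by (auto simp: compact_C2_domain_def)
  then interpret deformed_weight D "\<lambda>s. pot_V d t0 (t(k := s))" N k "real N / t0"
    using k by (rule deformed_weight_pot_V)
  \<comment> \<open>Updating \<open>t\<close> at \<open>k\<close> by its own value
    \<open>t k\<close> gives back \<open>t\<close>.\<close>
  have L: "L = mult_z_mat D (pot_V d t0 t) N"
    by (simp add: L_def Lfun_def)
  have w: "wirtinger_pair (\<lambda>s. Lfun s m n) (of_real c * commutator L (M_mat L k) m n)
      (of_real c * commutator (M_star_mat L k) L m n) (t k)" for m n
    unfolding L_def Lfun_def c_def by (rule toda_equations)
  have Mstar: "M_star_mat L k = adj (M_mat L k)"
    unfolding L_def Lfun_def by (rule M_star_mat_L)
  \<comment> \<open>Conjugating entry \<open>(n, m)\<close> swaps the two derivatives, and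
    adjunction turns \<open>commutator (M_star_mat L k) L\<close> into
    \<open>commutator (adj L) (M_mat L k)\<close>, and likewise for the other pair.\<close>
  have w_adj: "wirtinger_pair (\<lambda>s. adj (Lfun s) m n)
      (of_real c * commutator (adj L) (M_mat L k) m n)
      (of_real c * commutator (M_star_mat L k) (adj L) m n) (t k)" for m n
  proof -
    have adj_adj: "adj (adj A) = A" for A
      by (simp add: adj_def fun_eq_iff)
    show ?thesis
      using wirtinger_pair_cnj[OF w[of n m]] commutator_adj[of L "M_star_mat L k" m n]
        commutator_adj[of "M_mat L k" L m n]
      by (simp add: adj_def[of "Lfun _"] Mstar adj_adj)
  qed
  show "let Lfun = (\<lambda>s. mult_z_mat D (pot_V d t0 (t(k := s))) N);
          L = mult_z_mat D (pot_V d t0 t) N;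
          M = M_mat L k;
          Mstar = M_star_mat L k;
          c = complex_of_real (real N / t0)
      in mat_has_wirtinger Lfun (mat_scale c (commutator L M)) (t k)
       \<and> mat_has_wirtinger (\<lambda>s. adj (Lfun s)) (mat_scale c (commutator (adj L) M)) (t k)
       \<and> mat_has_wirtinger_bar Lfun (mat_scale c (commutator Mstar L)) (t k)
       \<and> mat_has_wirtinger_bar (\<lambda>s. adj (Lfun s)) (mat_scale c (commutator Mstar (adj L))) (t k)"
    unfolding Let_def L[symmetric] Lfun_def[symmetric] c_def[symmetric]
    by (simp only: mat_has_wirtinger_def mat_has_wirtinger_bar_def mat_scale_def
        wirtinger_pairD[OF w] wirtinger_pairD[OF w_adj] simp_thms)
qed simp

end
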